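(* Let $1\le n\le N$ and let $\Lambda$ be a positive definite diagonal $N\times N$ real matrix. The extremals of the variational problem $$\min_{Q(\cdot)}\int_0^T \tfrac12\operatorname{Tr}\big(\Lambda\,\dot Q^{\mathsf T}\dot Q\big)\,dt,\qquad Q(t)\in V(n,N),\quad Q(0)=Q_0,\ Q(T)=Q_T,$$ are the curves $Q(t)\in V(n,N)$ given by $$\dot Q=QU,\qquad U(t)\in\mathfrak{so}(N),$$ $$Q^{\mathsf T}Q\,\dot U\Lambda+\Lambda\dot U\,Q^{\mathsf T}Q=\Lambda U^2Q^{\mathsf T}Q-Q^{\mathsf T}Q\,U^2\Lambda .$$
   Context: $\mathbb R^{nN}$ denotes the real $n\times N$ matrices. The Stiefel manifold is $V(n,N)=\{Q\in\mathbb R^{nN}: QQ^{\mathsf T}=I_n\}$. $\mathfrak{so}(N)$ is the space of real skew-symmetric $N\times N$ matrices; every tangent vector to $V(n,N)$ at $Q$ has the form $QU$ with $U\in\mathfrak{so}(N)$. Curves $Q(t)$ and $U(t)$ are smooth. An extremal is a smooth curve in $V(n,N)$ with the prescribed endpoints at which the first variation of the integral vanishes for all variations $\delta Q=Q\Sigma$, with $\Sigma(t)\in\mathfrak{so}(N)$ smooth and $\Sigma(0)=\Sigma(T)=0$. *)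

theory Defs
  imports "HOL-Analysis.Analysis"
begin

(* C^k and C^infinity on S.  Derivatives are taken within S, hence one-sided at boundary points.
   The sets used below are intervals of positive length and products of two such intervals;
   on these, derivatives within S are unique. *)

fun C_on :: "nat \<Rightarrow> 'a::euclidean_space set \<Rightarrow> ('a \<Rightarrow> 'b::real_normed_vector) \<Rightarrow> bool" where
  "C_on 0 S f \<longleftrightarrow> continuous_on S f"
| "C_on (Suc k) S f \<longleftrightarrow>
     (\<exists>f'. (\<forall>x\<in>S. (f has_derivative f' x) (at x within S)) \<and> (\<forall>v. C_on k S (\<lambda>x. f' x v)))"

definition smooth_on :: "'a::euclidean_space set \<Rightarrow> ('a \<Rightarrow> 'b::real_normed_vector) \<Rightarrow> bool" where
  "smooth_on S f \<longleftrightarrow> (\<forall>k. C_on k S f)"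

definition diagonal_matrix :: "real^'N^'N \<Rightarrow> bool" where
  "diagonal_matrix A \<longleftrightarrow> (\<forall>i j. i \<noteq> j \<longrightarrow> A $ i $ j = 0)"

definition positive_definite :: "real^'N^'N \<Rightarrow> bool" where
  "positive_definite A \<longleftrightarrow> transpose A = A \<and> (\<forall>x. x \<noteq> 0 \<longrightarrow> 0 < x \<bullet> (A *v x))"

(* The n x N matrices (n rows, N columns) are the type real^'N^'n. *)
definition stiefel :: "(real^'N^'n) set" where
  "stiefel = {Q. Q ** transpose Q = mat 1}"

definition so :: "(real^'N^'N) set" where
  "so = {U. transpose U = - U}"

definition admissible_curve ::
  "real \<Rightarrow> real^'N^'n \<Rightarrow> real^'N^'n \<Rightarrow> (real \<Rightarrow> real^'N^'n) \<Rightarrow> bool" where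
  "admissible_curve T Q0 QT Q \<longleftrightarrow>
     smooth_on {0..T} Q \<and> (\<forall>t\<in>{0..T}. Q t \<in> stiefel) \<and> Q 0 = Q0 \<and> Q T = QT"

definition time_deriv :: "real \<Rightarrow> (real \<Rightarrow> 'a::real_normed_vector) \<Rightarrow> real \<Rightarrow> 'a" where
  "time_deriv T Q t = vector_derivative Q (at t within {0..T})"

definition cost :: "real^'N^'N \<Rightarrow> real \<Rightarrow> (real \<Rightarrow> real^'N^'n) \<Rightarrow> real" where
  "cost \<Lambda> T Q =
     integral {0..T} (\<lambda>t. 1/2 * trace (\<Lambda> ** transpose (time_deriv T Q t) ** time_deriv T Q t))"

(* q is a one-parameter family of admissible curves through Q, jointly smooth in the parameter
   and in time, whose variation field (the derivative in the parameter at 0) is Q \<Sigma>. *)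
definition variation ::
  "real \<Rightarrow> real^'N^'n \<Rightarrow> real^'N^'n \<Rightarrow> (real \<Rightarrow> real^'N^'n) \<Rightarrow> (real \<Rightarrow> real^'N^'N)
     \<Rightarrow> (real \<Rightarrow> real \<Rightarrow> real^'N^'n) \<Rightarrow> bool" where
  "variation T Q0 QT Q \<Sigma> q \<longleftrightarrow>
     (\<exists>e>0. smooth_on ({-e<..<e} \<times> {0..T}) (\<lambda>(\<epsilon>, t). q \<epsilon> t) \<and>
            (\<forall>\<epsilon>\<in>{-e<..<e}. admissible_curve T Q0 QT (q \<epsilon>))) \<and>
     (\<forall>t\<in>{0..T}. q 0 t = Q t) \<and>
     (\<forall>t\<in>{0..T}. ((\<lambda>\<epsilon>. q \<epsilon> t) has_vector_derivative Q t ** \<Sigma> t) (at 0))"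

definition extremal ::
  "real^'N^'N \<Rightarrow> real \<Rightarrow> real^'N^'n \<Rightarrow> real^'N^'n \<Rightarrow> (real \<Rightarrow> real^'N^'n) \<Rightarrow> bool" where
  "extremal \<Lambda> T Q0 QT Q \<longleftrightarrow>
     admissible_curve T Q0 QT Q \<and>
     (\<forall>\<Sigma> q. smooth_on {0..T} \<Sigma> \<and> (\<forall>t\<in>{0..T}. \<Sigma> t \<in> so) \<and> \<Sigma> 0 = 0 \<and> \<Sigma> T = 0 \<and>
             variation T Q0 QT Q \<Sigma> q
        \<longrightarrow> ((\<lambda>\<epsilon>. cost \<Lambda> T (q \<epsilon>)) has_real_derivative 0) (at 0))"

end

theory Submission
  imports Defs
begin

text \<open>
  Let \<open>\<langle>A, B\<rangle> = Tr (\<Lambda> A\<^sup>T B)\<close>. After integration by parts the first variation in the direction \<open>Q \<Sigma>\<close> is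
  \<open>- \<integral> \<langle>Q'', Q \<Sigma>\<rangle> = - \<integral> Tr (M \<Sigma>)\<close> with \<open>M = \<Lambda> Q''\<^sup>T Q\<close>. It vanishes for skew \<open>\<Sigma>\<close> when \<open>M\<close> is
  symmetric; conversely, variations rotating a single coordinate plane show that every entry of the
  skew part of \<open>M\<close> vanishes. If \<open>Q' = Q U\<close> with \<open>U\<close> skew, then \<open>Q'' = Q U\<^sup>2 + Q U'\<close>, and symmetry
  of \<open>M\<close> is the stated equation.
\<close>

section \<open>Calculus of smooth maps\<close>

lemma C_on_SucI:
  assumes "\<And>x. x \<in> S \<Longrightarrow> (f has_derivative f' x) (at x within S)"
    and "\<And>v. C_on k S (\<lambda>x. f' x v)"
  shows "C_on (Suc k) S f"
  using assms by auto

lemma C_on_SucE: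
  assumes "C_on (Suc k) S f"
  obtains f' where "\<forall>x\<in>S. (f has_derivative f' x) (at x within S)"
    and "\<forall>v. C_on k S (\<lambda>x. f' x v)"
proof -
  from assms obtain f' where
    "(\<forall>x\<in>S. (f has_derivative f' x) (at x within S)) \<and> (\<forall>v. C_on k S (\<lambda>x. f' x v))"
    unfolding C_on.simps(2) by (rule exE)
  then show thesis
    by (intro that[of f']) simp_all
qed

lemma C_on_cong:
  assumes "C_on k S f" and "\<And>x. x \<in> S \<Longrightarrow> f x = g x"
  shows "C_on k S g"
proof (cases k)
  case 0
  then show ?thesis using assms continuous_on_cong[of S S f g] by simp
next
  case (Suc m)
  from assms(1)[unfolded Suc] obtain f' where "\<forall>x\<in>S. (f has_derivative f' x) (at x within S)"
    "\<forall>v. C_on m S (\<lambda>x. f' x v)"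
    by (rule C_on_SucE)
  note f' = this[rule_format]
  have "(g has_derivative f' x) (at x within S)" if "x \<in> S" for x
    by (rule has_derivative_transform[OF that _ f'(1)[OF that]]) (simp add: assms(2))
  then show ?thesis unfolding Suc using f'(2) by (rule C_on_SucI)
qed

text \<open>Only the base case has content: differentiability implies continuity. The induction step
  lowers the order of the directional derivatives. Leibniz-type rules rely on this, because they
  leave one factor undifferentiated.\<close>

lemma C_on_SucD: "C_on (Suc k) S f \<Longrightarrow> C_on k S f"
proof (induction k arbitrary: f)
  case 0
  then obtain f' where "\<forall>x\<in>S. (f has_derivative f' x) (at x within S)"
    "\<forall>v. C_on 0 S (\<lambda>x. f' x v)"
    by (rule C_on_SucE)
  then have "continuous_on S f"
    using has_derivative_continuous_on[of S f f'] by simp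
  then show ?case by simp
next
  case (Suc k)
  from Suc.prems obtain f' where "\<forall>x\<in>S. (f has_derivative f' x) (at x within S)"
    "\<forall>v. C_on (Suc k) S (\<lambda>x. f' x v)"
    by (rule C_on_SucE)
  note f' = this[rule_format]
  show ?case
  proof (rule C_on_SucI)
    show "(f has_derivative f' x) (at x within S)" if "x \<in> S" for x
      by (rule f'(1)[OF that])
    show "C_on k S (\<lambda>x. f' x v)" for v
      by (rule Suc.IH[OF f'(2)])
  qed
qed

lemma C_on_const: "C_on k S (\<lambda>x. c)"
proof (induction k arbitrary: c)
  case (Suc k)
  show ?case
    by (rule C_on_SucI[where f' = "\<lambda>x v. 0"]) (rule has_derivative_const, rule Suc.IH)
qed simp

lemma C_on_add: "C_on k S f \<Longrightarrow> C_on k S g \<Longrightarrow> C_on k S (\<lambda>x. f x + g x)"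
proof (induction k arbitrary: f g)
  case 0
  then show ?case by (simp add: continuous_on_add)
next
  case (Suc k)
  from Suc.prems(1) obtain f' where
    "\<forall>x\<in>S. (f has_derivative f' x) (at x within S)" "\<forall>v. C_on k S (\<lambda>x. f' x v)"
    by (rule C_on_SucE)
  note f' = this[rule_format]
  from Suc.prems(2) obtain g' where
    "\<forall>x\<in>S. (g has_derivative g' x) (at x within S)" "\<forall>v. C_on k S (\<lambda>x. g' x v)"
    by (rule C_on_SucE)
  note g' = this[rule_format]
  show ?case
  proof (rule C_on_SucI)
    show "((\<lambda>x. f x + g x) has_derivative (\<lambda>v. f' x v + g' x v)) (at x within S)" if "x \<in> S" for x
      by (rule has_derivative_add[OF f'(1)[OF that] g'(1)[OF that]])
    show "C_on k S (\<lambda>x. f' x v + g' x v)" for v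
      by (rule Suc.IH[OF f'(2) g'(2)])
  qed
qed

lemma C_on_bounded_linear:
  assumes "bounded_linear h"
  shows "C_on k S f \<Longrightarrow> C_on k S (\<lambda>x. h (f x))"
proof (induction k arbitrary: f)
  case 0
  then show ?case by (simp add: bounded_linear.continuous_on[OF assms])
next
  case (Suc k)
  from Suc.prems obtain f' where
    "\<forall>x\<in>S. (f has_derivative f' x) (at x within S)" "\<forall>v. C_on k S (\<lambda>x. f' x v)"
    by (rule C_on_SucE)
  note f' = this[rule_format]
  show ?case
  proof (rule C_on_SucI)
    show "((\<lambda>x. h (f x)) has_derivative (\<lambda>v. h (f' x v))) (at x within S)" if "x \<in> S" for x
      by (rule bounded_linear.has_derivative[OF assms f'(1)[OF that]])
    show "C_on k S (\<lambda>x. h (f' x v))" for v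
      by (rule Suc.IH[OF f'(2)])
  qed
qed

lemma C_on_linear:
  assumes "bounded_linear h"
  shows "C_on k S h"
proof (cases k)
  case 0
  then show ?thesis by (simp add: linear_continuous_on[OF assms])
next
  case (Suc m)
  show ?thesis
    unfolding Suc
    by (intro C_on_SucI[where f' = "\<lambda>x. h"] C_on_const bounded_linear_imp_has_derivative[OF assms])
qed

text \<open>By the Leibniz rule a directional derivative is a sum of two terms of the same bilinear
  shape, each pairing an original map with a derivative. Hence the induction runs over arbitrary
  \<open>f\<close> and \<open>g\<close>.\<close>

lemma C_on_bilinear:
  assumes "bounded_bilinear h"
  shows "C_on k S f \<Longrightarrow> C_on k S g \<Longrightarrow> C_on k S (\<lambda>x. h (f x) (g x))"
proof (induction k arbitrary: f g)
  case 0
  then show ?case by (simp add: bounded_bilinear.continuous_on[OF assms])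
next
  case (Suc k)
  note le = C_on_SucD[OF Suc.prems(1)] C_on_SucD[OF Suc.prems(2)]
  from Suc.prems(1) obtain f' where
    "\<forall>x\<in>S. (f has_derivative f' x) (at x within S)" "\<forall>v. C_on k S (\<lambda>x. f' x v)"
    by (rule C_on_SucE)
  note f' = this[rule_format]
  from Suc.prems(2) obtain g' where
    "\<forall>x\<in>S. (g has_derivative g' x) (at x within S)" "\<forall>v. C_on k S (\<lambda>x. g' x v)"
    by (rule C_on_SucE)
  note g' = this[rule_format]
  show ?case
  proof (rule C_on_SucI)
    show "((\<lambda>x. h (f x) (g x)) has_derivative (\<lambda>v. h (f x) (g' x v) + h (f' x v) (g x))) (at x within S)"
      if "x \<in> S" for x
      by (rule bounded_bilinear.FDERIV[OF assms f'(1)[OF that] g'(1)[OF that]])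
    show "C_on k S (\<lambda>x. h (f x) (g' x v) + h (f' x v) (g x))" for v
      by (rule C_on_add[OF Suc.IH[OF le(1) g'(2)] Suc.IH[OF f'(2) le(2)]])
  qed
qed

text \<open>The two claims go through one induction because each function appears in the derivative
  of the other.\<close>

lemma C_on_sin_cos:
  fixes f :: "'a::euclidean_space \<Rightarrow> real"
  shows "C_on k S f \<Longrightarrow> C_on k S (\<lambda>x. sin (f x)) \<and> C_on k S (\<lambda>x. cos (f x))"
proof (induction k)
  case 0
  then show ?case by (auto intro!: continuous_intros)
next
  case (Suc k)
  note IH = Suc.IH[OF C_on_SucD[OF Suc.prems]]
  from Suc.prems obtain f' where
    "\<forall>x\<in>S. (f has_derivative f' x) (at x within S)" "\<forall>v. C_on k S (\<lambda>x. f' x v)"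
    by (rule C_on_SucE)
  note f' = this[rule_format]
  have C: "C_on k S (\<lambda>x. f' x v * cos (f x))" "C_on k S (\<lambda>x. - (f' x v * sin (f x)))" for v
    by (rule C_on_bilinear[OF bounded_bilinear_mult f'(2) IH[THEN conjunct2]])
      (rule C_on_bounded_linear[OF bounded_linear_minus[OF bounded_linear_ident]
        C_on_bilinear[OF bounded_bilinear_mult f'(2) IH[THEN conjunct1]]])
  have d: "((\<lambda>x. sin (f x)) has_derivative (\<lambda>v. f' x v * cos (f x))) (at x within S)"
    "((\<lambda>x. cos (f x)) has_derivative (\<lambda>v. - (f' x v * sin (f x)))) (at x within S)" if "x \<in> S" for x
    using has_derivative_sin[OF f'(1)[OF that]] has_derivative_cos[OF f'(1)[OF that]]
    by simp_all
  show ?case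
    using C_on_SucI[OF d(1) C(1)] C_on_SucI[OF d(2) C(2)] by (rule conjI)
qed

text \<open>For a fixed direction \<open>v\<close> the derivative is again a map of
  \<open>snd x\<close> alone, so the induction hypothesis applies to it and no chain rule of higher
  order arises.\<close>

lemma C_on_snd: "C_on k B f \<Longrightarrow> C_on k (A \<times> B) (\<lambda>x. f (snd x))"
proof (induction k arbitrary: f)
  case 0
  then show ?case by (auto intro!: continuous_on_compose2[of B f] continuous_intros)
next
  case (Suc k)
  from Suc.prems obtain f' where
    "\<forall>x\<in>B. (f has_derivative f' x) (at x within B)" "\<forall>v. C_on k B (\<lambda>x. f' x v)"
    by (rule C_on_SucE)
  note f' = this[rule_format]
  have "((\<lambda>x. f (snd x)) has_derivative (\<lambda>v. f' (snd x) (snd v))) (at x within A \<times> B)"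
    if "x \<in> A \<times> B" for x
  proof (rule has_derivative_in_compose2[where g = f and t = B])
    show "(snd has_derivative snd) (at x within A \<times> B)"
      by (rule bounded_linear_imp_has_derivative[OF bounded_linear_snd])
  qed (use that f' in auto)
  moreover have "C_on k (A \<times> B) (\<lambda>x. f' (snd x) (snd v))" for v
    by (rule Suc.IH[OF f'(2)])
  ultimately show ?case
    by (rule C_on_SucI)
qed

section \<open>Closure properties of smooth maps\<close>

lemma smooth_on_const: "smooth_on S (\<lambda>x. c)"
  by (simp add: smooth_on_def C_on_const)

lemma smooth_on_linear: "bounded_linear h \<Longrightarrow> smooth_on S h"
  by (simp add: smooth_on_def C_on_linear)

lemma smooth_on_bounded_linear: "bounded_linear h \<Longrightarrow> smooth_on S f \<Longrightarrow> smooth_on S (\<lambda>x. h (f x))"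
  by (simp add: smooth_on_def C_on_bounded_linear)

lemma smooth_on_bilinear:
  "bounded_bilinear h \<Longrightarrow> smooth_on S f \<Longrightarrow> smooth_on S g \<Longrightarrow> smooth_on S (\<lambda>x. h (f x) (g x))"
  by (simp add: smooth_on_def C_on_bilinear)

lemma smooth_on_add: "smooth_on S f \<Longrightarrow> smooth_on S g \<Longrightarrow> smooth_on S (\<lambda>x. f x + g x)"
  by (simp add: smooth_on_def C_on_add)

lemma smooth_on_minus: "smooth_on S f \<Longrightarrow> smooth_on S (\<lambda>x. - f x)"
  by (intro smooth_on_bounded_linear[where h = uminus] bounded_linear_minus bounded_linear_ident)

lemma smooth_on_diff: "smooth_on S f \<Longrightarrow> smooth_on S g \<Longrightarrow> smooth_on S (\<lambda>x. f x - g x)"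
  using smooth_on_add[OF _ smooth_on_minus, of S f g] by simp

lemma smooth_on_sin: "smooth_on S f \<Longrightarrow> smooth_on S (\<lambda>x. sin (f x :: real))"
  and smooth_on_cos: "smooth_on S f \<Longrightarrow> smooth_on S (\<lambda>x. cos (f x :: real))"
  by (simp_all add: smooth_on_def C_on_sin_cos)

lemma smooth_on_snd: "smooth_on B f \<Longrightarrow> smooth_on (A \<times> B) (\<lambda>x. f (snd x))"
  by (simp add: smooth_on_def C_on_snd)

lemma smooth_on_imp_continuous_on: "smooth_on S f \<Longrightarrow> continuous_on S f"
  using C_on.simps(1)[of S f] by (auto simp: smooth_on_def simp del: C_on.simps)

lemmas smooth_on_intros = smooth_on_const smooth_on_add smooth_on_minus smooth_on_diff
  smooth_on_sin smooth_on_cos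
  smooth_on_bilinear[OF bounded_bilinear_mult] smooth_on_bilinear[OF bounded_bilinear_scaleR]

section \<open>Time derivatives on a closed interval\<close>

lemma time_deriv_eq:
  assumes "0 < T" "t \<in> {0..T}" "(f has_vector_derivative D) (at t within {0..T})"
  shows "time_deriv T f t = D"
  using vector_derivative_within_cbox[of 0 T t f D] assms by (simp add: time_deriv_def)

lemma C_on_time_deriv:
  assumes "0 < T" "C_on (Suc k) {0..T} f"
  shows "C_on k {0..T} (time_deriv T f)"
    and "t \<in> {0..T} \<Longrightarrow> (f has_vector_derivative time_deriv T f t) (at t within {0..T})"
proof -
  from assms(2) obtain f' where "\<forall>x\<in>{0..T}. (f has_derivative f' x) (at x within {0..T})"
    "\<forall>v. C_on k {0..T} (\<lambda>x. f' x v)"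
    by (rule C_on_SucE)
  note f' = this[rule_format]
  have v: "(f has_vector_derivative f' x 1) (at x within {0..T})" if "x \<in> {0..T}" for x
  proof -
    \<comment> \<open>A linear map on the reals is determined by its value at 1, so the direction
      \<open>v = 1\<close> in \<open>C_on\<close> carries the whole time derivative.\<close>
    have "f' x = (\<lambda>h. h *\<^sub>R f' x 1)"
    proof
      show "f' x h = h *\<^sub>R f' x 1" for h
        using linear_scale[OF bounded_linear.linear[OF has_derivative_bounded_linear[OF f'(1)[OF that]]], of h 1]
        by simp
    qed
    with f'(1)[OF that] show ?thesis by (simp only: has_vector_derivative_def)
  qed
  have eq: "time_deriv T f x = f' x 1" if "x \<in> {0..T}" for x
    by (rule time_deriv_eq[OF assms(1) that v[OF that]])
  show "C_on k {0..T} (time_deriv T f)"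
    using C_on_cong[OF f'(2)[of 1]] eq by metis
  show "t \<in> {0..T} \<Longrightarrow> (f has_vector_derivative time_deriv T f t) (at t within {0..T})"
    using v eq by simp
qed

lemma smooth_on_time_deriv: "0 < T \<Longrightarrow> smooth_on {0..T} f \<Longrightarrow> smooth_on {0..T} (time_deriv T f)"
  unfolding smooth_on_def using C_on_time_deriv(1) by blast

lemma smooth_has_time_deriv:
  "0 < T \<Longrightarrow> smooth_on {0..T} f \<Longrightarrow> t \<in> {0..T} \<Longrightarrow>
    (f has_vector_derivative time_deriv T f t) (at t within {0..T})"
  unfolding smooth_on_def using C_on_time_deriv(2) by blast

section \<open>Partial derivatives along the two sides of a product\<close>

lemma has_derivative_slice_fst:
  assumes "(F has_derivative D) (at (x, t) within A \<times> B)" "t \<in> B"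
  shows "((\<lambda>s. F (s, t)) has_vector_derivative D (1, 0)) (at x within A)"
proof -
  have "((\<lambda>s. F (s, t)) has_derivative (\<lambda>h. D (h, 0))) (at x within A)"
    using assms by (intro has_derivative_in_compose[where g = F and f = "\<lambda>s. (s, t)"])
      (auto intro!: derivative_eq_intros has_derivative_subset[OF assms(1)])
  moreover have "(\<lambda>h. D (h, 0)) = (\<lambda>h. h *\<^sub>R D (1, 0))"
  proof
    show "D (h, 0) = h *\<^sub>R D (1, 0)" for h
      using linear_scale[OF bounded_linear.linear[OF has_derivative_bounded_linear[OF assms(1)]], of h "(1, 0)"]
      by simp
  qed
  ultimately show ?thesis by (simp only: has_vector_derivative_def)
qed

lemma has_derivative_slice_snd:
  assumes "(F has_derivative D) (at (x, t) within A \<times> B)" "x \<in> A"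
  shows "((\<lambda>s. F (x, s)) has_vector_derivative D (0, 1)) (at t within B)"
proof -
  have "((\<lambda>s. F (x, s)) has_derivative (\<lambda>h. D (0, h))) (at t within B)"
    using assms by (intro has_derivative_in_compose[where g = F and f = "\<lambda>s. (x, s)"])
      (auto intro!: derivative_eq_intros has_derivative_subset[OF assms(1)])
  moreover have "(\<lambda>h. D (0, h)) = (\<lambda>h. h *\<^sub>R D (0, 1))"
  proof
    show "D (0, h) = h *\<^sub>R D (0, 1)" for h
      using linear_scale[OF bounded_linear.linear[OF has_derivative_bounded_linear[OF assms(1)]], of h "(0, 1)"]
      by simp
  qed
  ultimately show ?thesis by (simp only: has_vector_derivative_def)
qed

section \<open>Matrix algebra\<close>

lemma bounded_bilinear_matrix_mult:
  "bounded_bilinear ((**) :: real^'m^'n \<Rightarrow> real^'p^'m \<Rightarrow> real^'p^'n)"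
  unfolding bilinear_conv_bounded_bilinear[symmetric] bilinear_def
  by (auto intro!: linearI
      simp: matrix_matrix_mult_def vec_eq_iff sum.distrib sum_distrib_left algebra_simps)

lemmas matrix_mult_simps =
  bounded_bilinear.minus_left[OF bounded_bilinear_matrix_mult]
  bounded_bilinear.minus_right[OF bounded_bilinear_matrix_mult]
  bounded_bilinear.diff_left[OF bounded_bilinear_matrix_mult]
  bounded_bilinear.diff_right[OF bounded_bilinear_matrix_mult]
  bounded_bilinear.add_left[OF bounded_bilinear_matrix_mult]
  bounded_bilinear.add_right[OF bounded_bilinear_matrix_mult]
  bounded_bilinear.scaleR_left[OF bounded_bilinear_matrix_mult]
  bounded_bilinear.scaleR_right[OF bounded_bilinear_matrix_mult]
  bounded_bilinear.zero_left[OF bounded_bilinear_matrix_mult]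
  bounded_bilinear.zero_right[OF bounded_bilinear_matrix_mult]

lemma linear_transpose: "linear (transpose :: real^'m^'n \<Rightarrow> real^'n^'m)"
  by (auto intro!: linearI simp: transpose_def vec_eq_iff)

lemmas bounded_linear_transpose = linear_linear[THEN iffD2, OF linear_transpose]

lemmas transpose_simps = linear_add[OF linear_transpose] linear_diff[OF linear_transpose]
  linear_neg[OF linear_transpose] linear_scale[OF linear_transpose]

lemma linear_trace: "linear (trace :: real^'n^'n \<Rightarrow> real)"
  by (auto intro!: linearI simp: trace_def sum.distrib sum_distrib_left)

lemma trace_transpose: "trace (transpose A) = trace A"
  by (simp add: trace_def transpose_def)

lemma bounded_bilinear_trace:
  fixes L :: "real^'N^'N"
  shows "bounded_bilinear (\<lambda>A B :: real^'N^'n. trace (L ** transpose A ** B))"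
  unfolding bilinear_conv_bounded_bilinear[symmetric] bilinear_def
  by (auto intro!: linearI simp: matrix_mult_simps transpose_simps linear_add[OF linear_trace]
      linear_scale[OF linear_trace])

text \<open>Transposition preserves the trace, and cyclicity brings the symmetric \<open>L\<close>
  back to the front. The symmetry merges the two product-rule terms of the quadratic cost and so
  absorbs its factor 1/2.\<close>

lemma trace_form_commute:
  fixes L :: "real^'N^'N" and A B :: "real^'N^'n"
  assumes "transpose L = L"
  shows "trace (L ** transpose A ** B) = trace (L ** transpose B ** A)"
proof -
  have "trace (L ** transpose A ** B) = trace (transpose (L ** transpose A ** B))"
    by (simp add: trace_transpose)
  also have "\<dots> = trace (transpose B ** A ** L)"
    by (simp add: matrix_transpose_mul assms matrix_mul_assoc)
  also have "\<dots> = trace (L ** transpose B ** A)"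
    by (simp add: trace_mul_sym[of "transpose B ** A"] matrix_mul_assoc)
  finally show ?thesis .
qed

section \<open>The first variation\<close>

text \<open>Differentiating \<open>q \<epsilon> t = Q\<^sub>0 + \<integral>\<^sub>0\<^sup>t \<partial>\<^sub>t q \<epsilon> s ds\<close> under the integral at \<open>\<epsilon> = 0\<close> identifies
  \<open>W = \<partial>\<^sub>\<epsilon> \<partial>\<^sub>t q\<close> with the time derivative of \<open>Q \<Sigma>\<close>; symmetry of mixed partials up to the boundary of the
  strip is not needed.\<close>

lemma variation_first_order:
  fixes L :: "real^'N^'N" and Q :: "real \<Rightarrow> real^'N^'n"
  assumes L: "transpose L = L" and T: "0 < T" and var: "variation T Q0 QT Q \<Sigma> q"
  obtains W where "continuous_on {0..T} W"
    and "\<And>t. t \<in> {0..T} \<Longrightarrow> ((\<lambda>t. Q t ** \<Sigma> t) has_vector_derivative W t) (at t within {0..T})"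
    and "((\<lambda>\<epsilon>. cost L T (q \<epsilon>)) has_real_derivative
           integral {0..T} (\<lambda>t. trace (L ** transpose (time_deriv T Q t) ** W t))) (at 0)"
proof -
  from var obtain e where e: "e > 0"
    and sm: "smooth_on ({-e<..<e} \<times> {0..T}) (\<lambda>(\<epsilon>, t). q \<epsilon> t)"
    and adm: "\<And>\<epsilon>. \<epsilon> \<in> {-e<..<e} \<Longrightarrow> admissible_curve T Q0 QT (q \<epsilon>)"
    and q0: "\<And>t. t \<in> {0..T} \<Longrightarrow> q 0 t = Q t"
    and field: "\<And>t. t \<in> {0..T} \<Longrightarrow> ((\<lambda>\<epsilon>. q \<epsilon> t) has_vector_derivative Q t ** \<Sigma> t) (at 0)"
    unfolding variation_def by blast
  define I where "I = {-e<..<e}"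
  define S where "S = I \<times> {0..T}"
  have I: "open I" "convex I" "0 \<in> I"
    using e by (auto simp: I_def)
  \<comment> \<open>Two orders suffice: the direction \<open>(0, 1)\<close> gives the time
    derivative \<open>V\<close>, and differentiating \<open>V\<close> in the direction
    \<open>(1, 0)\<close> gives the mixed derivative \<open>W\<close>.\<close>
  have "C_on (Suc (Suc 0)) S (\<lambda>(\<epsilon>, t). q \<epsilon> t)"
    using sm unfolding smooth_on_def S_def I_def by blast
  then obtain F' where "\<forall>x\<in>S. ((\<lambda>(\<epsilon>, t). q \<epsilon> t) has_derivative F' x) (at x within S)"
    and "\<forall>v. C_on (Suc 0) S (\<lambda>x. F' x v)"
    by (rule C_on_SucE)
  note F' = this(1)[rule_format] and C1 = this(2)[rule_format]
  define V where "V x = F' x (0, 1)" for x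
  have contV: "continuous_on S V"
    using C_on_SucD[OF C1] by (simp add: V_def)
  from C1[of "(0, 1)"] obtain V' where "\<forall>x\<in>S. (V has_derivative V' x) (at x within S)"
    and "\<forall>v. C_on 0 S (\<lambda>x. V' x v)"
    unfolding V_def[symmetric] by (rule C_on_SucE)
  note V' = this(1)[rule_format] and C2 = this(2)[unfolded C_on.simps(1), rule_format]
  define W where "W x = V' x (1, 0)" for x
  have contW: "continuous_on S W"
    using C2 by (simp add: W_def)
  have slice: "continuous_on {0..T} (\<lambda>t. V (\<epsilon>, t))" "continuous_on {0..T} (\<lambda>t. W (\<epsilon>, t))"
    if "\<epsilon> \<in> I" for \<epsilon>
    using that by (auto intro!: continuous_on_compose2[OF contV] continuous_on_compose2[OF contW]
        continuous_intros simp: S_def)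
  have dt: "(q \<epsilon> has_vector_derivative V (\<epsilon>, t)) (at t within {0..T})"
    if "\<epsilon> \<in> I" "t \<in> {0..T}" for \<epsilon> t
    using has_derivative_slice_snd[OF F'[of "(\<epsilon>, t)", unfolded S_def]] that by (simp add: V_def)
  have d\<epsilon>: "((\<lambda>\<epsilon>. V (\<epsilon>, t)) has_vector_derivative W (\<epsilon>, t)) (at \<epsilon> within I)"
    if "\<epsilon> \<in> I" "t \<in> {0..T}" for \<epsilon> t
    using has_derivative_slice_fst[OF V'[of "(\<epsilon>, t)", unfolded S_def]] that by (simp add: W_def)
  have TD: "time_deriv T (q \<epsilon>) t = V (\<epsilon>, t)" if "\<epsilon> \<in> I" "t \<in> {0..T}" for \<epsilon> t
    using time_deriv_eq[OF T] dt that by blast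
  \<comment> \<open>\<open>q 0\<close> and \<open>Q\<close> agree only on the interval, which is
    enough for derivatives taken within it.\<close>
  have TDQ: "time_deriv T Q t = V (0, t)" if "t \<in> {0..T}" for t
    using has_vector_derivative_transform[OF that, of Q "q 0"] q0 dt[OF I(3) that]
    by (intro time_deriv_eq[OF T that]) auto

  have prim: "Q t ** \<Sigma> t = integral {0..t} (\<lambda>s. W (0, s))" if t: "t \<in> {0..T}" for t
  proof -
    have sub: "{0..t} \<subseteq> {0..T}" using t by auto
    have "((\<lambda>\<epsilon>. integral (cbox 0 t) (\<lambda>s. V (\<epsilon>, s))) has_vector_derivative
        integral (cbox 0 t) (\<lambda>s. W (0, s))) (at 0 within I)"
    proof (rule leibniz_rule_vector_derivative)
      show "((\<lambda>\<epsilon>. V (\<epsilon>, s)) has_vector_derivative W (\<epsilon>, s)) (at \<epsilon> within I)"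
        if "\<epsilon> \<in> I" "s \<in> cbox 0 t" for \<epsilon> s
        using that sub by (intro d\<epsilon>) auto
      show "(\<lambda>s. V (\<epsilon>, s)) integrable_on cbox 0 t" if "\<epsilon> \<in> I" for \<epsilon>
        using continuous_on_subset[OF slice(1)[OF that] sub] by (simp add: integrable_continuous_real)
      have "I \<times> cbox 0 t \<subseteq> S"
        using sub by (auto simp: S_def)
      from continuous_on_subset[OF contW this]
      show "continuous_on (I \<times> cbox 0 t) (\<lambda>(\<epsilon>, s). W (\<epsilon>, s))"
        by (simp add: split_beta)
    qed (use I in auto)
    then have "((\<lambda>\<epsilon>. integral {0..t} (\<lambda>s. V (\<epsilon>, s))) has_vector_derivative
        integral {0..t} (\<lambda>s. W (0, s))) (at 0)"
      using at_within_open[OF I(3,1)] by simp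
    then have "((\<lambda>\<epsilon>. Q0 + integral {0..t} (\<lambda>s. V (\<epsilon>, s))) has_vector_derivative
        integral {0..t} (\<lambda>s. W (0, s))) (at 0)"
      by (auto intro!: derivative_eq_intros)
    \<comment> \<open>The common starting point makes the constant of integration independent of the
      parameter.\<close>
    moreover have "Q0 + integral {0..t} (\<lambda>s. V (\<epsilon>, s)) = q \<epsilon> t" if "\<epsilon> \<in> I" for \<epsilon>
    proof -
      have "((\<lambda>s. V (\<epsilon>, s)) has_integral q \<epsilon> t - q \<epsilon> 0) {0..t}"
        using t sub by (intro fundamental_theorem_of_calculus)
          (auto intro: has_vector_derivative_within_subset[OF dt[OF that]])
      moreover have "q \<epsilon> 0 = Q0"
        using adm that unfolding admissible_curve_def I_def by blast
      ultimately show ?thesis by (simp add: integral_unique)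
    qed
    ultimately have "((\<lambda>\<epsilon>. q \<epsilon> t) has_vector_derivative integral {0..t} (\<lambda>s. W (0, s))) (at 0)"
      by (rule has_vector_derivative_transform_within_open[OF _ I(1,3)])
    \<comment> \<open>Both the prescribed variation field and the integral of \<open>W\<close> are
      the parameter derivative of \<open>q\<close> at 0.\<close>
    with field[OF t] show ?thesis
      using vector_derivative_unique_at by blast
  qed
  have "((\<lambda>t. Q t ** \<Sigma> t) has_vector_derivative W (0, t)) (at t within {0..T})"
    if "t \<in> {0..T}" for t
    by (rule has_vector_derivative_transform[OF that _ integral_has_vector_derivative[OF slice(2)[OF I(3)] that]])
      (rule prim)
  moreover have "((\<lambda>\<epsilon>. cost L T (q \<epsilon>)) has_real_derivative
           integral {0..T} (\<lambda>t. trace (L ** transpose (time_deriv T Q t) ** W (0, t)))) (at 0)"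
  proof -
    let ?b = "\<lambda>A B :: real^'N^'n. trace (L ** transpose A ** B)"
    note b = bounded_bilinear_trace[of L, where 'n = 'n]
    \<comment> \<open>The Leibniz rule again, now for the cost integrand; joint continuity of
      \<open>V\<close> and \<open>W\<close> on the strip justifies it.\<close>
    have "((\<lambda>\<epsilon>. integral (cbox 0 T) (\<lambda>t. 1/2 * ?b (V (\<epsilon>, t)) (V (\<epsilon>, t)))) has_vector_derivative
        integral (cbox 0 T) (\<lambda>t. ?b (V (0, t)) (W (0, t)))) (at 0 within I)"
    proof (rule leibniz_rule_vector_derivative[where fx = "\<lambda>\<epsilon> t. ?b (V (\<epsilon>, t)) (W (\<epsilon>, t))"])
      fix \<epsilon> t assume \<epsilon>: "\<epsilon> \<in> I" and "t \<in> cbox 0 T"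
      then have t: "t \<in> {0..T}" by simp
      have "((\<lambda>\<epsilon>. ?b (V (\<epsilon>, t)) (V (\<epsilon>, t))) has_vector_derivative
          ?b (V (\<epsilon>, t)) (W (\<epsilon>, t)) + ?b (W (\<epsilon>, t)) (V (\<epsilon>, t))) (at \<epsilon> within I)"
        using bounded_bilinear.has_vector_derivative[OF b d\<epsilon>[OF \<epsilon> t] d\<epsilon>[OF \<epsilon> t]] .
      moreover have "?b (W (\<epsilon>, t)) (V (\<epsilon>, t)) = ?b (V (\<epsilon>, t)) (W (\<epsilon>, t))"
        by (rule trace_form_commute[OF L])
      ultimately show "((\<lambda>\<epsilon>. 1/2 * ?b (V (\<epsilon>, t)) (V (\<epsilon>, t))) has_vector_derivative
          ?b (V (\<epsilon>, t)) (W (\<epsilon>, t))) (at \<epsilon> within I)"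
        using has_vector_derivative_mult_right[of _ _ _ "1/2"] by fastforce
    next
      fix \<epsilon> assume "\<epsilon> \<in> I"
      then show "(\<lambda>t. 1/2 * ?b (V (\<epsilon>, t)) (V (\<epsilon>, t))) integrable_on cbox 0 T"
        using slice(1) by (auto intro!: integrable_continuous_real continuous_intros
            bounded_bilinear.continuous_on[OF b])
    next
      show "continuous_on (I \<times> cbox 0 T) (\<lambda>(\<epsilon>, t). ?b (V (\<epsilon>, t)) (W (\<epsilon>, t)))"
        using bounded_bilinear.continuous_on[OF b contV contW] by (simp add: S_def split_beta)
    qed (use I in auto)
    moreover have "integral {0..T} (\<lambda>t. ?b (V (0, t)) (W (0, t)))
        = integral {0..T} (\<lambda>t. ?b (time_deriv T Q t) (W (0, t)))"
      by (intro integral_cong) (simp add: TDQ)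
    ultimately have "((\<lambda>\<epsilon>. integral {0..T} (\<lambda>t. 1/2 * ?b (V (\<epsilon>, t)) (V (\<epsilon>, t)))) has_real_derivative
        integral {0..T} (\<lambda>t. ?b (time_deriv T Q t) (W (0, t)))) (at 0)"
      unfolding at_within_open[OF I(3,1)] cbox_interval
      by (simp only: has_real_derivative_iff_has_vector_derivative)
    moreover have "integral {0..T} (\<lambda>t. 1/2 * ?b (V (\<epsilon>, t)) (V (\<epsilon>, t))) = cost L T (q \<epsilon>)"
      if "\<epsilon> \<in> I" for \<epsilon>
      unfolding cost_def using TD[OF that] by (intro integral_cong) simp
    ultimately show ?thesis
      by (rule has_field_derivative_transform_within_open[OF _ I(1,3)])
  qed
  ultimately show thesis
    using that[of "\<lambda>t. W (0, t)"] slice(2)[OF I(3)] by blast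
qed

lemma first_variation_formula:
  fixes L :: "real^'N^'N" and Q :: "real \<Rightarrow> real^'N^'n"
  assumes L: "transpose L = L" and T: "0 < T" and Q: "smooth_on {0..T} Q"
    and var: "variation T Q0 QT Q \<Sigma> q" and bc: "\<Sigma> 0 = 0" "\<Sigma> T = 0"
  shows "((\<lambda>\<epsilon>. cost L T (q \<epsilon>)) has_real_derivative
    - integral {0..T} (\<lambda>t. trace (L ** transpose (time_deriv T (time_deriv T Q) t) ** Q t ** \<Sigma> t))) (at 0)"
proof -
  let ?b = "\<lambda>A B :: real^'N^'n. trace (L ** transpose A ** B)"
  note b = bounded_bilinear_trace[of L, where 'n = 'n]
  let ?D = "time_deriv T Q" and ?DD = "time_deriv T (time_deriv T Q)"
  obtain W where W: "continuous_on {0..T} W"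
    "\<And>t. t \<in> {0..T} \<Longrightarrow> ((\<lambda>t. Q t ** \<Sigma> t) has_vector_derivative W t) (at t within {0..T})"
    and dcost: "((\<lambda>\<epsilon>. cost L T (q \<epsilon>)) has_real_derivative integral {0..T} (\<lambda>t. ?b (?D t) (W t))) (at 0)"
    using variation_first_order[OF L T var] by blast
  have D: "smooth_on {0..T} ?D" "smooth_on {0..T} ?DD"
    using smooth_on_time_deriv[OF T] Q by blast+
  have cont: "continuous_on {0..T} ?D" "continuous_on {0..T} ?DD"
    "continuous_on {0..T} (\<lambda>t. Q t ** \<Sigma> t)"
    using D W(2) continuous_on_vector_derivative[of "{0..T}" "\<lambda>t. Q t ** \<Sigma> t" W]
    by (auto intro: smooth_on_imp_continuous_on)
  \<comment> \<open>Integration by parts: the integrand is the derivative of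
    \<open>?b (?D t) (Q t ** \<Sigma> t)\<close>, whose boundary values vanish with
    \<Sigma>.\<close>
  have "((\<lambda>t. ?b (?D t) (W t) + ?b (?DD t) (Q t ** \<Sigma> t)) has_integral
      ?b (?D T) (Q T ** \<Sigma> T) - ?b (?D 0) (Q 0 ** \<Sigma> 0)) {0..T}"
    using T by (intro fundamental_theorem_of_calculus
        bounded_bilinear.has_vector_derivative[OF b smooth_has_time_deriv[OF T D(1)] W(2)]) auto
  then have "integral {0..T} (\<lambda>t. ?b (?D t) (W t) + ?b (?DD t) (Q t ** \<Sigma> t)) = 0"
    by (simp add: integral_unique bc matrix_mult_simps linear_0[OF linear_trace])
  moreover have "(\<lambda>t. ?b (?D t) (W t)) integrable_on {0..T}"
    "(\<lambda>t. ?b (?DD t) (Q t ** \<Sigma> t)) integrable_on {0..T}"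
    using cont W(1) by (auto intro!: integrable_continuous_real bounded_bilinear.continuous_on[OF b])
  ultimately have "integral {0..T} (\<lambda>t. ?b (?D t) (W t)) = - integral {0..T} (\<lambda>t. ?b (?DD t) (Q t ** \<Sigma> t))"
    by (simp add: integral_add)
  with dcost show ?thesis by (simp add: matrix_mul_assoc)
qed

section \<open>The Euler--Lagrange equation\<close>

text \<open>Transposition followed by cyclicity turns the trace into its own negative.\<close>

lemma trace_symmetric_skew:
  fixes M S :: "real^'N^'N"
  assumes "transpose M = M" "transpose S = - S"
  shows "trace (M ** S) = 0"
proof -
  have "trace (M ** S) = trace (transpose (M ** S))"
    by (simp add: trace_transpose)
  also have "\<dots> = - trace (S ** M)"
    by (simp add: matrix_transpose_mul assms matrix_mult_simps linear_neg[OF linear_trace])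
  finally show ?thesis
    by (simp add: trace_mul_sym[of S])
qed

lemma euler_lagrange_iff_symmetric:
  fixes L :: "real^'N^'N" and Q :: "real \<Rightarrow> real^'N^'n"
  assumes L: "transpose L = L" and T: "0 < T" and Q: "smooth_on {0..T} Q"
    and U: "smooth_on {0..T} U" "\<forall>t\<in>{0..T}. U t \<in> so"
    and QU: "\<forall>t\<in>{0..T}. time_deriv T Q t = Q t ** U t" and t: "t \<in> {0..T}"
  defines "M \<equiv> L ** transpose (time_deriv T (time_deriv T Q) t) ** Q t"
  shows "transpose (Q t) ** Q t ** time_deriv T U t ** L + L ** time_deriv T U t ** transpose (Q t) ** Q t
         = L ** U t ** U t ** transpose (Q t) ** Q t - transpose (Q t) ** Q t ** U t ** U t ** L
    \<longleftrightarrow> transpose M = M"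
proof -
  note der = smooth_has_time_deriv[OF T]
  have "((\<lambda>t. Q t ** U t) has_vector_derivative Q t ** time_deriv T U t + time_deriv T Q t ** U t)
      (at t within {0..T})"
    by (rule bounded_bilinear.has_vector_derivative[OF bounded_bilinear_matrix_mult
        der[OF Q t] der[OF U(1) t]])
  then have "(time_deriv T Q has_vector_derivative Q t ** time_deriv T U t + time_deriv T Q t ** U t)
      (at t within {0..T})"
    by (rule has_vector_derivative_transform[OF t, rotated]) (simp add: QU)
  then have "(time_deriv T Q has_vector_derivative Q t ** time_deriv T U t + Q t ** U t ** U t)
      (at t within {0..T})"
    using QU t by simp
  then have DD: "time_deriv T (time_deriv T Q) t = Q t ** time_deriv T U t + Q t ** U t ** U t"
    by (rule time_deriv_eq[OF T t])
  \<comment> \<open>Computing the derivative of the transpose of \<open>U\<close> in two ways shows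
    that the derivative of \<open>U\<close> is skew as well.\<close>
  have "((\<lambda>t. transpose (U t)) has_vector_derivative transpose (time_deriv T U t)) (at t within {0..T})"
    by (rule bounded_linear.has_vector_derivative[OF bounded_linear_transpose der[OF U(1) t]])
  moreover have "((\<lambda>t. transpose (U t)) has_vector_derivative - time_deriv T U t) (at t within {0..T})"
    by (rule has_vector_derivative_transform[OF t _ has_vector_derivative_minus[OF der[OF U(1) t]]])
      (use U(2) in \<open>simp add: so_def\<close>)
  ultimately have DU: "transpose (time_deriv T U t) = - time_deriv T U t"
    using vector_derivative_unique_within_closed_interval[of 0 T t] T t by simp
  have Ut: "transpose (U t) = - U t"
    using U(2) t by (simp add: so_def)
  \<comment> \<open>Here skewness of \<open>U\<close> and of its derivative removes the transposes.
    In the transpose of \<open>M\<close> below, the second derivative of \<open>Q\<close> appears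
    untransposed and only symmetry of \<open>L\<close> enters. Equating the two expressions and
    moving terms across gives the stated equation.\<close>
  have M: "M = L ** U t ** U t ** transpose (Q t) ** Q t - L ** time_deriv T U t ** transpose (Q t) ** Q t"
    unfolding M_def DD
    by (simp add: matrix_transpose_mul transpose_simps DU Ut matrix_mult_simps matrix_mul_assoc)
  have "transpose M = transpose (Q t) ** Q t ** U t ** U t ** L + transpose (Q t) ** Q t ** time_deriv T U t ** L"
    unfolding M_def DD
    by (simp add: matrix_transpose_mul transpose_simps L matrix_mult_simps matrix_mul_assoc)
  then show ?thesis
    unfolding M by (auto simp: algebra_simps)
qed

text \<open>\<open>Q\<^sup>T Q' - Q'\<^sup>T Q\<close> is skew and \<open>Q\<close> maps it to \<open>Q' - Q Q'\<^sup>T Q = Q' + Q' Q\<^sup>T Q\<close>; the third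
  term removes the excess, and is skew because \<open>Q' Q\<^sup>T\<close> is.\<close>

lemma stiefel_skew_velocity:
  fixes Q :: "real \<Rightarrow> real^'N^'n"
  assumes T: "0 < T" and Q: "smooth_on {0..T} Q" and st: "\<forall>t\<in>{0..T}. Q t \<in> stiefel"
  obtains U where "smooth_on {0..T} U" "\<forall>t\<in>{0..T}. U t \<in> so"
    "\<forall>t\<in>{0..T}. time_deriv T Q t = Q t ** U t"
proof -
  define U where "U t = transpose (Q t) ** time_deriv T Q t - transpose (time_deriv T Q t) ** Q t
    - transpose (Q t) ** time_deriv T Q t ** transpose (Q t) ** Q t" for t
  \<comment> \<open>This is the derivative of the constraint
    \<open>Q t ** transpose (Q t) = mat 1\<close>.\<close>
  have skew: "Q t ** transpose (time_deriv T Q t) = - (time_deriv T Q t ** transpose (Q t))"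
    if t: "t \<in> {0..T}" for t
  proof -
    note d = smooth_has_time_deriv[OF T Q t]
    have "((\<lambda>t. Q t ** transpose (Q t)) has_vector_derivative
        Q t ** transpose (time_deriv T Q t) + time_deriv T Q t ** transpose (Q t)) (at t within {0..T})"
      by (rule bounded_bilinear.has_vector_derivative[OF bounded_bilinear_matrix_mult d
          bounded_linear.has_vector_derivative[OF bounded_linear_transpose d]])
    moreover have "((\<lambda>t. Q t ** transpose (Q t)) has_vector_derivative 0) (at t within {0..T})"
      by (rule has_vector_derivative_transform[OF t _ has_vector_derivative_const[of "mat 1"]])
        (use st in \<open>simp add: stiefel_def\<close>)
    ultimately have "Q t ** transpose (time_deriv T Q t) + time_deriv T Q t ** transpose (Q t) = 0"
      using vector_derivative_unique_within_closed_interval[of 0 T t] T t by simp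
    then show ?thesis by (simp add: eq_neg_iff_add_eq_0)
  qed
  show thesis
  proof (rule that)
    show "smooth_on {0..T} U"
      unfolding U_def
      by (intro smooth_on_diff smooth_on_bilinear[OF bounded_bilinear_matrix_mult]
          smooth_on_bounded_linear[OF bounded_linear_transpose] smooth_on_time_deriv T Q)
    show "\<forall>t\<in>{0..T}. U t \<in> so"
    proof
      fix t assume t: "t \<in> {0..T}"
      \<comment> \<open>Sandwiching the skew relation between the transpose of \<open>Q\<close> and
        \<open>Q\<close> makes the third term of \<open>U\<close> skew; the difference of the first
        two is skew by its form.\<close>
      have "transpose (Q t) ** (Q t ** transpose (time_deriv T Q t)) ** Q t
          = - (transpose (Q t) ** (time_deriv T Q t ** transpose (Q t)) ** Q t)"
        unfolding skew[OF t] by (simp add: matrix_mult_simps)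
      then have "transpose (Q t) ** Q t ** transpose (time_deriv T Q t) ** Q t
          = - (transpose (Q t) ** time_deriv T Q t ** transpose (Q t) ** Q t)"
        by (simp add: matrix_mul_assoc)
      then show "U t \<in> so"
        by (simp add: so_def U_def transpose_simps matrix_transpose_mul matrix_mul_assoc)
    qed
    show "\<forall>t\<in>{0..T}. time_deriv T Q t = Q t ** U t"
    proof
      fix t assume t: "t \<in> {0..T}"
      have st': "Q t ** transpose (Q t) = mat 1"
        using st t by (simp add: stiefel_def)
      have "Q t ** transpose (time_deriv T Q t) ** Q t = - (time_deriv T Q t ** transpose (Q t) ** Q t)"
        by (simp add: skew[OF t] matrix_mult_simps)
      then show "time_deriv T Q t = Q t ** U t"
        by (simp add: U_def matrix_mult_simps matrix_mul_assoc st')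
    qed
  qed
qed

section \<open>Variations by plane rotations\<close>

text \<open>The value of \<open>exp (\<theta> S)\<close> when \<open>S\<^sup>3 = - S\<close>.\<close>

definition rotation :: "real^'N^'N \<Rightarrow> real \<Rightarrow> real^'N^'N" where
  "rotation S \<theta> = mat 1 + sin \<theta> *\<^sub>R S + (1 - cos \<theta>) *\<^sub>R (S ** S)"

text \<open>With \<open>P = S ** S\<close> every product reduces to a combination of
  \<open>mat 1\<close>, \<open>S\<close> and \<open>P\<close>. The \<open>S\<close> terms cancel,
  and for \<open>c = 1 - cos \<theta>\<close> the coefficient of \<open>P\<close> is
  \<open>2 * c - c * c - sin \<theta> * sin \<theta>\<close>, which is 0.\<close>

lemma rotation_orthogonal:
  assumes "transpose S = - S" and S3: "S ** S ** S = - S"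
  shows "rotation S \<theta> ** transpose (rotation S \<theta>) = mat 1"
proof -
  define P where "P = S ** S"
  have P: "P ** S = - S" "S ** P = - S" "P ** P = - P"
    using S3 by (simp_all add: P_def matrix_mul_assoc matrix_mult_simps)
  have R: "rotation S \<theta> = mat 1 + sin \<theta> *\<^sub>R S + (1 - cos \<theta>) *\<^sub>R P"
    by (simp add: rotation_def P_def)
  have RT: "transpose (rotation S \<theta>) = mat 1 - sin \<theta> *\<^sub>R S + (1 - cos \<theta>) *\<^sub>R P"
    by (simp add: rotation_def P_def transpose_simps matrix_transpose_mul assms matrix_mult_simps)
  have "(cos \<theta> * cos \<theta>) *\<^sub>R P + (sin \<theta> * sin \<theta>) *\<^sub>R P = P"
    by (simp flip: scaleR_left_distrib power2_eq_square)
  then show ?thesis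
    unfolding RT unfolding R by (simp add: matrix_mult_simps P P_def[symmetric] algebra_simps)
qed

lemma smooth_on_rotation:
  assumes "smooth_on X f"
  shows "smooth_on X (\<lambda>x. rotation S (f x))"
  unfolding rotation_def using assms by (intro smooth_on_intros)

text \<open>Right multiplication by an orthogonal matrix stays in the Stiefel manifold, and zeros of
  \<phi> at both ends keep the endpoints fixed. This realises the field \<phi> S by an explicit
  family of curves.\<close>

lemma rotation_variation:
  fixes Q :: "real \<Rightarrow> real^'N^'n"
  assumes adm: "admissible_curve T Q0 QT Q"
    and S: "transpose S = - S" "S ** S ** S = - S"
    and \<phi>: "smooth_on {0..T} \<phi>" "\<phi> 0 = 0" "\<phi> T = 0"
  shows "variation T Q0 QT Q (\<lambda>t. \<phi> t *\<^sub>R S) (\<lambda>\<epsilon> t. Q t ** rotation S (\<epsilon> * \<phi> t))"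
  unfolding variation_def
\<comment> \<open>The radius 1 is arbitrary: the rotated curve is admissible for every parameter
  value.\<close>
proof (intro conjI exI[of _ 1] ballI)
  have Q: "smooth_on {0..T} Q" and st: "\<And>t. t \<in> {0..T} \<Longrightarrow> Q t ** transpose (Q t) = mat 1"
    and bd: "Q 0 = Q0" "Q T = QT"
    using adm by (auto simp: admissible_curve_def stiefel_def)
  have rot0: "rotation S 0 = mat 1"
    by (simp add: rotation_def)
  show "(0::real) < 1" by simp
  have "smooth_on ({-1<..<1} \<times> {0..T})
      (\<lambda>x. Q (snd x) ** rotation S (fst x * \<phi> (snd x)))"
    by (intro smooth_on_bilinear[OF bounded_bilinear_matrix_mult] smooth_on_snd[OF Q]
        smooth_on_rotation smooth_on_bilinear[OF bounded_bilinear_mult] smooth_on_snd[OF \<phi>(1)]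
        smooth_on_linear bounded_linear_fst)
  then show "smooth_on ({-1<..<1} \<times> {0..T}) (\<lambda>(\<epsilon>, t). Q t ** rotation S (\<epsilon> * \<phi> t))"
    by (simp add: split_beta')
  show "admissible_curve T Q0 QT (\<lambda>t. Q t ** rotation S (\<epsilon> * \<phi> t))" for \<epsilon>
    unfolding admissible_curve_def
  proof (intro conjI ballI)
    show "smooth_on {0..T} (\<lambda>t. Q t ** rotation S (\<epsilon> * \<phi> t))"
      by (intro smooth_on_bilinear[OF bounded_bilinear_matrix_mult] Q
        smooth_on_rotation smooth_on_bilinear[OF bounded_bilinear_mult] \<phi>(1) smooth_on_const)
    show "Q t ** rotation S (\<epsilon> * \<phi> t) \<in> stiefel" if t: "t \<in> {0..T}" for t
    proof -
      let ?R = "rotation S (\<epsilon> * \<phi> t)"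
      have "Q t ** ?R ** transpose (Q t ** ?R) = Q t ** (?R ** transpose ?R) ** transpose (Q t)"
        by (simp add: matrix_transpose_mul matrix_mul_assoc)
      then show ?thesis
        by (simp add: stiefel_def rotation_orthogonal[OF S] st[OF t])
    qed
  qed (simp_all add: \<phi> rot0 bd)
  show "Q t ** rotation S (0 * \<phi> t) = Q t" for t
    by (simp add: rot0)
  show "((\<lambda>\<epsilon>. Q t ** rotation S (\<epsilon> * \<phi> t)) has_vector_derivative Q t ** (\<phi> t *\<^sub>R S)) (at 0)" for t
  proof (rule bounded_linear.has_vector_derivative[OF
        bounded_bilinear.bounded_linear_right[OF bounded_bilinear_matrix_mult]])
    show "((\<lambda>\<epsilon>. rotation S (\<epsilon> * \<phi> t)) has_vector_derivative \<phi> t *\<^sub>R S) (at 0)"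
    proof -
      \<comment> \<open>The cosine coefficient is stationary at 0, so only the \<open>S\<close> term
        contributes to the derivative.\<close>
      have d: "((\<lambda>\<epsilon>. sin (\<epsilon> * \<phi> t)) has_vector_derivative \<phi> t) (at 0)"
        "((\<lambda>\<epsilon>. 1 - cos (\<epsilon> * \<phi> t)) has_vector_derivative 0) (at 0)"
        unfolding has_real_derivative_iff_has_vector_derivative[symmetric]
        by (auto intro!: derivative_eq_intros)
      note scale = bounded_linear.has_vector_derivative[OF bounded_linear_scaleR_left]
      show ?thesis
        using has_vector_derivative_add[OF has_vector_derivative_add[OF
            has_vector_derivative_const[of "mat 1"] scale[OF d(1), of S]] scale[OF d(2), of "S ** S"]]
        by (simp add: rotation_def)
    qed
  qed
qed

text \<open>\<open>axis i (axis j 1)\<close> is the matrix unit with its 1 in row \<open>i\<close>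
  and column \<open>j\<close>. For distinct indices the difference generates the rotations of the
  coordinate plane of \<open>i\<close> and \<open>j\<close>.\<close>

definition plane_skew :: "'N \<Rightarrow> 'N \<Rightarrow> real^'N^'N" where
  "plane_skew i j = axis i (axis j 1) - axis j (axis i 1)"

lemma matrix_unit_nth:
  "(axis a (axis b 1) :: real^'m^'n) $ k $ l = (if k = a \<and> l = b then 1 else 0)"
  by (simp add: axis_def)

lemma matrix_unit_mult:
  "axis a (axis b 1) ** axis c (axis d 1) = (if b = c then axis a (axis d 1) else (0 :: real^'p^'n))"
proof -
  have "(axis a (axis b 1) ** axis c (axis d 1) :: real^'p^'n) $ k $ l
      = (if b = c then axis a (axis d 1) else (0 :: real^'p^'n)) $ k $ l" for k l
  proof -
    have "(axis a (axis b 1) ** axis c (axis d 1) :: real^'p^'n) $ k $ l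
        = (\<Sum>m\<in>UNIV. if m = b then if k = a \<and> b = c \<and> l = d then 1 else 0 else 0)"
      unfolding matrix_matrix_mult_def vec_lambda_beta matrix_unit_nth
      by (rule sum.cong) simp_all
    also have "\<dots> = (if b = c then axis a (axis d 1) else (0 :: real^'p^'n)) $ k $ l"
      by (simp add: matrix_unit_nth)
    finally show ?thesis .
  qed
  then show ?thesis by (simp add: vec_eq_iff)
qed

lemma transpose_matrix_unit: "transpose (axis a (axis b 1) :: real^'m^'n) = axis b (axis a 1)"
  by (simp add: vec_eq_iff transpose_def matrix_unit_nth)

lemma trace_matrix_unit: "trace (M ** (axis a (axis b 1) :: real^'N^'N)) = M $ b $ a"
proof -
  have "(M ** (axis a (axis b 1) :: real^'N^'N)) $ k $ k = (if k = b then M $ b $ a else 0)" for k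
  proof -
    have "(M ** (axis a (axis b 1) :: real^'N^'N)) $ k $ k
        = (\<Sum>m\<in>UNIV. if m = a then if k = b then M $ b $ a else 0 else 0)"
      unfolding matrix_matrix_mult_def vec_lambda_beta matrix_unit_nth
      by (rule sum.cong) simp_all
    then show ?thesis by simp
  qed
  then show ?thesis by (simp add: trace_def)
qed

lemma transpose_plane_skew: "transpose (plane_skew i j) = - plane_skew i j"
  by (simp add: plane_skew_def transpose_simps transpose_matrix_unit)

text \<open>The square is minus the orthogonal projection onto the coordinate plane, and that
  projection fixes \<open>plane_skew i j\<close>.\<close>

lemma plane_skew_cube: "i \<noteq> j \<Longrightarrow> plane_skew i j ** plane_skew i j ** plane_skew i j = - plane_skew i j"
  by (simp add: plane_skew_def matrix_mult_simps matrix_unit_mult)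

text \<open>Pairing with these generators reads off the entries of \<open>transpose M - M\<close>
  one at a time.\<close>

lemma trace_plane_skew: "trace (M ** plane_skew i j) = M $ j $ i - M $ i $ j"
  by (simp add: plane_skew_def matrix_mult_simps linear_diff[OF linear_trace] trace_matrix_unit)

text \<open>Replaces the fundamental lemma of the calculus of variations: testing \<open>g\<close> against
  \<open>t (T - t) g(t)\<close>, which is as smooth as \<open>g\<close>, makes bump functions unnecessary.\<close>

lemma eq_zero_if_weighted_square_integral_zero:
  fixes g :: "real \<Rightarrow> real"
  assumes T: "0 < T" and g: "continuous_on {0..T} g"
    and int: "integral {0..T} (\<lambda>t. t * (T - t) * g t * g t) = 0"
    and t: "t \<in> {0..T}"
  shows "g t = 0"
proof -
  have "continuous_on {0..T} (\<lambda>s. s * (T - s) * g s * g s)"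
    by (intro continuous_intros g)
  moreover have "0 \<le> s * (T - s) * g s * g s" if "s \<in> {0..T}" for s
    using that mult_nonneg_nonneg[of "s * (T - s)" "g s * g s"] by (simp add: mult.assoc)
  \<comment> \<open>A continuous nonnegative function with zero integral vanishes
    identically.\<close>
  ultimately have zero: "\<forall>s\<in>{0..T}. s * (T - s) * g s * g s = 0"
    using int integral_eq_0_iff[of 0 T "\<lambda>s. s * (T - s) * g s * g s"] T by blast
  \<comment> \<open>In the interior the weight is positive and can be cancelled; the endpoints
    follow from continuity of \<open>g\<close>.\<close>
  have "g s = 0" if s: "s \<in> {0<..<T}" for s
  proof -
    have "s * (T - s) * g s * g s = 0"
      by (rule zero[rule_format]) (use s in simp)
    then show ?thesis using s by simp
  qed
  then show ?thesis
    using continuous_constant_on_closure[of "{0<..<T}" g 0 t] g t T by simp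
qed

section \<open>Extremals\<close>

lemma extremal_iff_symmetric:
  fixes L :: "real^'N^'N" and Q :: "real \<Rightarrow> real^'N^'n"
  assumes L: "transpose L = L" and T: "0 < T" and adm: "admissible_curve T Q0 QT Q"
  defines "M \<equiv> \<lambda>t. L ** transpose (time_deriv T (time_deriv T Q) t) ** Q t"
  shows "extremal L T Q0 QT Q \<longleftrightarrow> (\<forall>t\<in>{0..T}. transpose (M t) = M t)"
proof
  have Q: "smooth_on {0..T} Q"
    using adm by (simp add: admissible_curve_def)
  have dcost: "((\<lambda>\<epsilon>. cost L T (q \<epsilon>)) has_real_derivative - integral {0..T} (\<lambda>t. trace (M t ** \<Sigma> t))) (at 0)"
    if "variation T Q0 QT Q \<Sigma> q" "\<Sigma> 0 = 0" "\<Sigma> T = 0" for \<Sigma> q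
    using first_variation_formula[OF L T Q that] by (simp add: M_def)
  show "extremal L T Q0 QT Q" if sym: "\<forall>t\<in>{0..T}. transpose (M t) = M t"
    unfolding extremal_def
  proof (intro conjI allI impI)
    fix \<Sigma> q
    assume *: "smooth_on {0..T} \<Sigma> \<and> (\<forall>t\<in>{0..T}. \<Sigma> t \<in> so) \<and> \<Sigma> 0 = 0 \<and> \<Sigma> T = 0 \<and>
             variation T Q0 QT Q \<Sigma> q"
    have "integral {0..T} (\<lambda>t. trace (M t ** \<Sigma> t)) = integral {0..T} (\<lambda>t. 0)"
      using * sym by (intro integral_cong trace_symmetric_skew) (auto simp: so_def)
    with dcost[of \<Sigma> q] * show "((\<lambda>\<epsilon>. cost L T (q \<epsilon>)) has_real_derivative 0) (at 0)"
      by simp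
  qed (rule adm)
  show "\<forall>t\<in>{0..T}. transpose (M t) = M t" if ext: "extremal L T Q0 QT Q"
  proof
    fix t assume t: "t \<in> {0..T}"
    have M: "smooth_on {0..T} M"
      unfolding M_def
      by (intro smooth_on_bilinear[OF bounded_bilinear_matrix_mult] smooth_on_const
          smooth_on_bounded_linear[OF bounded_linear_transpose] smooth_on_time_deriv T Q)
    have "M t $ i $ j = M t $ j $ i" if "i \<noteq> j" for i j
    proof -
      \<comment> \<open>The weight in \<phi> provides the zeros at the endpoints, and the factor
        \<open>g\<close> turns the first variation into a weighted integral of the square of
        \<open>g\<close>.\<close>
      define g where "g t = M t $ j $ i - M t $ i $ j" for t
      define \<phi> where "\<phi> t = t * (T - t) * g t" for t
      have g: "smooth_on {0..T} g"
        unfolding g_def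
        by (intro smooth_on_diff smooth_on_bounded_linear[OF bounded_linear_vec_nth] M)
      have \<phi>: "smooth_on {0..T} \<phi>" "\<phi> 0 = 0" "\<phi> T = 0"
        unfolding \<phi>_def
        by (intro smooth_on_bilinear[OF bounded_bilinear_mult] smooth_on_diff smooth_on_const g
            smooth_on_linear bounded_linear_ident) simp_all
      note S = transpose_plane_skew[of i j] plane_skew_cube[OF that]
      note var = rotation_variation[OF adm S \<phi>]
      have sm: "smooth_on {0..T} (\<lambda>t. \<phi> t *\<^sub>R plane_skew i j)"
        by (intro smooth_on_bilinear[OF bounded_bilinear_scaleR] \<phi>(1) smooth_on_const)
      have skew: "\<phi> t *\<^sub>R plane_skew i j \<in> so" for t
        by (simp add: so_def transpose_simps transpose_plane_skew)
      have stat: "((\<lambda>\<epsilon>. cost L T (\<lambda>t. Q t ** rotation (plane_skew i j) (\<epsilon> * \<phi> t)))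
          has_real_derivative 0) (at 0)"
        by (rule ext[unfolded extremal_def, THEN conjunct2, rule_format, OF conjI[OF sm]])
          (use skew var \<phi> in simp)
      have "((\<lambda>\<epsilon>. cost L T (\<lambda>t. Q t ** rotation (plane_skew i j) (\<epsilon> * \<phi> t)))
          has_real_derivative - integral {0..T} (\<lambda>t. trace (M t ** (\<phi> t *\<^sub>R plane_skew i j)))) (at 0)"
        by (rule dcost[OF var]) (simp_all add: \<phi>)
      \<comment> \<open>The formula for the first variation and stationarity give the same
        derivative, so the integral vanishes.\<close>
      from DERIV_unique[OF this stat]
      have "integral {0..T} (\<lambda>t. trace (M t ** (\<phi> t *\<^sub>R plane_skew i j))) = 0"
        by simp
      then have "integral {0..T} (\<lambda>t. t * (T - t) * g t * g t) = 0"
        by (simp add: matrix_mult_simps linear_scale[OF linear_trace] trace_plane_skew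
            g_def[symmetric] \<phi>_def)
      from eq_zero_if_weighted_square_integral_zero[OF T smooth_on_imp_continuous_on[OF g] this t]
      show ?thesis by (simp add: g_def)
    qed
    then show "transpose (M t) = M t"
      unfolding vec_eq_iff transpose_def by (metis vec_lambda_beta)
  qed
qed

theorem theorem1:
  fixes \<Lambda> :: "real^'N^'N" and Q0 QT :: "real^'N^'n" and T :: real
    and Q :: "real \<Rightarrow> real^'N^'n"
  assumes "1 \<le> CARD('n)" and "CARD('n) \<le> CARD('N)"
    and "diagonal_matrix \<Lambda>" and "positive_definite \<Lambda>"
    and "0 < T"
  shows "extremal \<Lambda> T Q0 QT Q \<longleftrightarrow>
    admissible_curve T Q0 QT Q \<and>
    (\<exists>U. smooth_on {0..T} U \<and> (\<forall>t\<in>{0..T}. U t \<in> so) \<and>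
      (\<forall>t\<in>{0..T}. time_deriv T Q t = Q t ** U t) \<and>
      (\<forall>t\<in>{0..T}.
         transpose (Q t) ** Q t ** time_deriv T U t ** \<Lambda> + \<Lambda> ** time_deriv T U t ** transpose (Q t) ** Q t
         = \<Lambda> ** U t ** U t ** transpose (Q t) ** Q t - transpose (Q t) ** Q t ** U t ** U t ** \<Lambda>))"
    (is "_ \<longleftrightarrow> ?R" is "_ \<longleftrightarrow> _ \<and> (\<exists>U. ?P U)" is "_ \<longleftrightarrow> _ \<and> (\<exists>U. _ U \<and> _ U \<and> _ U \<and> (\<forall>t\<in>{0..T}. ?EL U t))")
proof -
  have L: "transpose \<Lambda> = \<Lambda>"
    using assms by (simp add: positive_definite_def)
  let ?M = "\<lambda>t. \<Lambda> ** transpose (time_deriv T (time_deriv T Q) t) ** Q t"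
  show ?thesis
  proof (cases "admissible_curve T Q0 QT Q")
    case False
    then show ?thesis by (simp add: extremal_def)
  next
    case True
    then have Q: "smooth_on {0..T} Q" "\<forall>t\<in>{0..T}. Q t \<in> stiefel"
      by (auto simp: admissible_curve_def)
    note ext = extremal_iff_symmetric[OF L \<open>0 < T\<close> True]
    \<comment> \<open>The right-hand side does not mention \<open>U\<close>: the equation holds for
      one skew velocity exactly when it holds for all of them. So one constructed \<open>U\<close>
      serves the forward direction and any given \<open>U\<close> the converse.\<close>
    have EL: "?EL U t \<longleftrightarrow> transpose (?M t) = ?M t"
      if "smooth_on {0..T} U" "\<forall>t\<in>{0..T}. U t \<in> so"
        "\<forall>t\<in>{0..T}. time_deriv T Q t = Q t ** U t" "t \<in> {0..T}" for U t
      by (rule euler_lagrange_iff_symmetric[OF L \<open>0 < T\<close> Q(1) that])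
    obtain U where U: "smooth_on {0..T} U" "\<forall>t\<in>{0..T}. U t \<in> so"
      "\<forall>t\<in>{0..T}. time_deriv T Q t = Q t ** U t"
      by (rule stiefel_skew_velocity[OF \<open>0 < T\<close> Q])
    show ?thesis
    proof
      assume *: "extremal \<Lambda> T Q0 QT Q"
      have EL_U: "\<forall>t\<in>{0..T}. ?EL U t"
      proof
        show "?EL U t" if t: "t \<in> {0..T}" for t
          by (rule iffD2[OF EL[OF U t] bspec[OF iffD1[OF ext *] t]])
      qed
      have "?P U"
        by (rule conjI[OF U(1) conjI[OF U(2) conjI[OF U(3) EL_U]]])
      then have "\<exists>U. ?P U"
        by (rule exI[of "\<lambda>U. ?P U" U])
      with True show ?R
        by (rule conjI)
    next
      assume ?R
      then have "\<exists>U. ?P U"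
        by (rule conjunct2)
      then obtain U where P: "?P U"
        by (rule exE)
      note U = P[THEN conjunct1] P[THEN conjunct2, THEN conjunct1]
        P[THEN conjunct2, THEN conjunct2, THEN conjunct1]
      note EL_U = P[THEN conjunct2, THEN conjunct2, THEN conjunct2]
      have "\<forall>t\<in>{0..T}. transpose (?M t) = ?M t"
      proof
        show "transpose (?M t) = ?M t" if t: "t \<in> {0..T}" for t
          by (rule iffD1[OF EL[OF U t] bspec[OF EL_U t]])
      qed
      with ext show "extremal \<Lambda> T Q0 QT Q"
        by (rule iffD2)
    qed
  qed
qed

end
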